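(* Let $\boldsymbol f\in\mathcal V^*$, $\boldsymbol u_0\in\boldsymbol H$, and let $\psi$ satisfy (i)–(iv) of the context. Suppose that either (a) $(\boldsymbol u,p)\in\mathcal W\times\mathcal Q$ satisfies, for a.e. $t\in(0,T)$, $$\boldsymbol u'(t)+A\boldsymbol u(t)-B^*p(t)+\gamma^*\partial\Psi(t,\gamma\boldsymbol u(t))\ni\boldsymbol f(t),\qquad B\boldsymbol u(t)=0,$$ and $\boldsymbol u(0)=\boldsymbol u_0$; or (b) $(\boldsymbol u,p,\boldsymbol\xi)\in\mathcal W\times\mathcal Q\times\mathcal S^*$ satisfies, for a.e. $t\in(0,T)$, $$\boldsymbol u'(t)+A\boldsymbol u(t)-B^*p(t)+\gamma^*\boldsymbol\xi(t)=\boldsymbol f(t),\qquad \boldsymbol\xi(t)\in\partial\Psi(t,\gamma\boldsymbol u(t)),\qquad B\boldsymbol u(t)=0,$$ and $\boldsymbol u(0)=\boldsymbol u_0$. Then $(\boldsymbol u,p)\in\mathcal W\times\mathcal Q$ satisfies, for a.e. $t\in(0,T)$, $$\langle \boldsymbol u'(t),\boldsymbol v\rangle_{\boldsymbol V^*\times\boldsymbol V}+a(\boldsymbol u(t),\boldsymbol v)-b(\boldsymbol v,p(t))+\Psi^0(t,\gamma\boldsymbol u(t);\gamma\boldsymbol v)\ \ge\ \langle\boldsymbol f(t),\boldsymbol v\rangle_{\boldsymbol V^*\times\boldsymbol V}\quad\forall\,\boldsymbol v\in\boldsymbol V,$$ $b(\boldsymbol u(t),q)=0$ for all $q\in Q$,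 and $\boldsymbol u(0)=\boldsymbol u_0$.
   Context: Domain: $d\in\{2,3\}$; $\Omega\subset\mathbb R^d$ is a bounded Lipschitz domain with boundary $\Gamma=\Gamma_D\cup\Gamma_S$, where $\Gamma_D$ (relatively closed) and $\Gamma_S$ (relatively open) are disjoint and of positive surface measure; $T>0$; $\mu>0$ is a constant. $\boldsymbol\nu$ is the unit outward normal on $\Gamma$; for a vector field $\boldsymbol v$, $v_\nu=\boldsymbol v\cdot\boldsymbol\nu$ and $\boldsymbol v_\tau=\boldsymbol v-v_\nu\boldsymbol\nu$ on $\Gamma$ (in the sense of traces). $\boldsymbol\varepsilon(\boldsymbol v)=(\nabla\boldsymbol v+(\nabla\boldsymbol v)^T)/2$. Spaces: $\boldsymbol V=\{\boldsymbol v\in H^1(\Omega)^d\mid \boldsymbol v=\boldsymbol 0\text{ on }\Gamma_D,\ v_\nu=0\text{ on }\Gamma_S\}$ with inner product $(\boldsymbol u,\boldsymbol v)_{\boldsymbol V}=\int_\Omega\boldsymbol\varepsilon(\boldsymbol u):\boldsymbol\varepsilon(\boldsymbol v)\,dx$ (a Hilbert space, with norm equivalent to the $H^1$ norm by Korn's inequality); $\boldsymbol H=L^2(\Omega)^d$, identified with its dual so that $\boldsymbol V\subset\boldsymbol H\subset\boldsymbol V^*$; $Q=\{q\in L^2(\Omega)\mid\int_\Omega q\,dx=0\}$; $\mathcal V=L^2(0,T;\boldsymbol V)$, $\mathcal V^*=L^2(0,T;\boldsymbol V^* )$; $\mathcal W=\{\boldsymbol v\in\mathcal V\mid\boldsymbol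 v'\in\mathcal V^*\}$, with $\boldsymbol v'$ the generalized time derivative (so $\mathcal W\subset C([0,T];\boldsymbol H)$ and $\boldsymbol u(0)$ is meaningful); $\mathcal Q=L^2(0,T;Q)$; $\boldsymbol S=L^2(\Gamma_S)^d$, $\mathcal S=L^2(0,T;\boldsymbol S)$, $\mathcal S^*=L^2(0,T;\boldsymbol S^* )$. Forms and operators: $a(\boldsymbol u,\boldsymbol v)=2\mu\int_\Omega\boldsymbol\varepsilon(\boldsymbol u):\boldsymbol\varepsilon(\boldsymbol v)\,dx$; $b(\boldsymbol v,q)=\int_\Omega q\,\mathrm{div}\,\boldsymbol v\,dx$; $A:\boldsymbol V\to\boldsymbol V^*$ with $\langle A\boldsymbol u,\boldsymbol v\rangle=a(\boldsymbol u,\boldsymbol v)$; $B:\boldsymbol V\to Q^*$ with $\langle B\boldsymbol v,q\rangle=b(\boldsymbol v,q)$, and $B^*:Q\to\boldsymbol V^*$ its adjoint, $\langle B^*q,\boldsymbol v\rangle=b(\boldsymbol v,q)$; $\gamma:\boldsymbol V\to\boldsymbol S$, $\gamma\boldsymbol v=\boldsymbol v_\tau|_{\Gamma_S}$, with adjoint $\gamma^*:\boldsymbol S^*\to\boldsymbol V^*$. The inclusion in (a) means that for a.e. $t$ there is an element $\boldsymbol\eta\in\partial\Psi(t,\gamma\boldsymbol u(t))$ with $\boldsymbol u'(t)+A\boldsymbol u(t)-B^*p(t)+\gamma^*\boldsymbol\eta=\boldsymbol f(t)$ in $\boldsymbol V^*$. Clarke calculus: for a locally Lipschitz $\Phi:X\to\mathbb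 R$ on a Banach space $X$, $\Phi^0(u;v)=\limsup_{w\to u,\ \lambda\downarrow0}\frac{\Phi(w+\lambda v)-\Phi(w)}{\lambda}$ and $\partial\Phi(u)=\{\xi\in X^*\mid\Phi^0(u;v)\ge\langle\xi,v\rangle\ \forall v\in X\}$. $\partial\psi(\boldsymbol x,t,\boldsymbol\xi)$ is taken with respect to the last variable $\boldsymbol\xi\in\mathbb R^d$. Conditions on $\psi:\Gamma_S\times(0,T)\times\mathbb R^d\to\mathbb R$: (i) $\psi(\cdot,\cdot,\boldsymbol\xi)$ is measurable on $\Gamma_S\times(0,T)$ for all $\boldsymbol\xi\in\mathbb R^d$, and there is $\boldsymbol\xi_0\in L^2(\Gamma_S)^d$ with $\psi(\cdot,t,\boldsymbol\xi_0(\cdot))\in L^1(\Gamma_S)$ for a.e. $t\in(0,T)$; (ii) $\psi(\boldsymbol x,t,\cdot)$ is locally Lipschitz on $\mathbb R^d$ for a.e. $(\boldsymbol x,t)$; (iii) there is $c_0>0$ with $|\boldsymbol\eta|\le c_0(1+|\boldsymbol\xi|)$ for all $\boldsymbol\xi\in\mathbb R^d$, $\boldsymbol\eta\in\partial\psi(\boldsymbol x,t,\boldsymbol\xi)$, a.e. $(\boldsymbol x,t)$; (iv) there is a constant $\alpha_\psi>0$ with $(\boldsymbol\eta_1-\boldsymbol\eta_2)\cdot(\boldsymbol\xi_1-\boldsymbol\xi_2)\ge-\alpha_\psi|\boldsymbol\xi_1-\boldsymbol\xi_2|^2$ for all $\boldsymbol\xi_i\in\mathbb R^d$, $\boldsymbol\eta_i\in\partial\psi(\boldsymbol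 x,t,\boldsymbol\xi_i)$, $i=1,2$, a.e. $(\boldsymbol x,t)$. Functional: $\Psi(t,\boldsymbol z)=\int_{\Gamma_S}\psi(\boldsymbol x,t,\boldsymbol z(\boldsymbol x))\,ds$ for $\boldsymbol z\in\boldsymbol S$; $\Psi^0(t,\boldsymbol z;\boldsymbol w)$ and $\partial\Psi(t,\boldsymbol z)\subset\boldsymbol S^*$ are its Clarke generalized directional derivative and subdifferential with respect to $\boldsymbol z$. *)

theory Defs
  imports "HOL-Analysis.Analysis" "HOL-Library.Function_Algebras"
begin

section \<open>Seminormed spaces of functions, duals, Bochner spaces\<close>

text \<open>
  The spaces of the problem depend on the domain, so they are not types. A space is given by a
  carrier set and a seminorm; elements are functions (not classes), and two
  functions denote the same element when the seminorm of their difference vanishes. Functions carry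
  the pointwise vector space structure.
\<close>

instantiation "fun" :: (type, real_vector) real_vector
begin

definition scaleR_fun :: "real \<Rightarrow> ('a \<Rightarrow> 'b) \<Rightarrow> 'a \<Rightarrow> 'b" where
  "scaleR_fun c f = (\<lambda>x. c *\<^sub>R f x)"

instance
  by standard (auto simp: scaleR_fun_def fun_eq_iff algebra_simps)

end

text \<open>
  A functional only matters through its values on the carrier; equality in the dual is
  equality on the carrier. Boundedness by the seminorm makes functionals respect the
  identification of functions that denote the same element.
\<close>

definition dual_space :: "'x::real_vector set \<Rightarrow> ('x \<Rightarrow> real) \<Rightarrow> ('x \<Rightarrow> real) set" where
  "dual_space X N = {\<xi>. (\<forall>x\<in>X. \<forall>y\<in>X. \<xi> (x + y) = \<xi> x + \<xi> y) \<and>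
                         (\<forall>c. \<forall>x\<in>X. \<xi> (c *\<^sub>R x) = c * \<xi> x) \<and>
                         (\<exists>C. \<forall>x\<in>X. \<bar>\<xi> x\<bar> \<le> C * N x)}"

definition dual_norm :: "'x::real_vector set \<Rightarrow> ('x \<Rightarrow> real) \<Rightarrow> ('x \<Rightarrow> real) \<Rightarrow> real" where
  "dual_norm X N \<xi> = Sup {\<bar>\<xi> x\<bar> | x. x \<in> X \<and> N x \<le> 1}"

abbreviation time_measure :: "real \<Rightarrow> real measure" where
  "time_measure T \<equiv> lebesgue_on {0<..<T}"

definition strongly_measurable ::
    "real \<Rightarrow> 'x::real_vector set \<Rightarrow> ('x \<Rightarrow> real) \<Rightarrow> (real \<Rightarrow> 'x) \<Rightarrow> bool" where
  "strongly_measurable T X N f \<longleftrightarrow>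
     (\<exists>s :: nat \<Rightarrow> real \<Rightarrow> 'x.
        (\<forall>n. simple_function (time_measure T) (s n) \<and> (\<forall>t\<in>{0<..<T}. s n t \<in> X)) \<and>
        (AE t in time_measure T. (\<lambda>n. N (s n t - f t)) \<longlonglongrightarrow> 0))"

text \<open>The space \<open>L\<^sup>2(0,T;X)\<close>.\<close>

definition bochner_L2 ::
    "real \<Rightarrow> 'x::real_vector set \<Rightarrow> ('x \<Rightarrow> real) \<Rightarrow> (real \<Rightarrow> 'x) set" where
  "bochner_L2 T X N = {f. (AE t in time_measure T. f t \<in> X) \<and>
                          strongly_measurable T X N f \<and>
                          integrable (time_measure T) (\<lambda>t. (N (f t))\<^sup>2)}"

definition L2_space :: "'a measure \<Rightarrow> ('a \<Rightarrow> 'b::euclidean_space) set" where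
  "L2_space M = {f. f \<in> borel_measurable M \<and> integrable M (\<lambda>x. (norm (f x))\<^sup>2)}"

definition L2_norm :: "'a measure \<Rightarrow> ('a \<Rightarrow> 'b::euclidean_space) \<Rightarrow> real" where
  "L2_norm M f = sqrt (\<integral>x. (norm (f x))\<^sup>2 \<partial>M)"


section \<open>Clarke calculus\<close>

definition seminorm_nhds :: "'x::real_vector set \<Rightarrow> ('x \<Rightarrow> real) \<Rightarrow> 'x \<Rightarrow> 'x filter" where
  "seminorm_nhds X N u = (INF e\<in>{0<..}. principal {w \<in> X. N (w - u) < e})"

text \<open>
  The limit superior is taken in the extended reals, where it always exists; it is finite
  whenever \<open>\<Phi>\<close> is Lipschitz near \<open>u\<close>.
\<close>

definition clarke_deriv ::
    "'x::real_vector set \<Rightarrow> ('x \<Rightarrow> real) \<Rightarrow> ('x \<Rightarrow> real) \<Rightarrow> 'x \<Rightarrow> 'x \<Rightarrow> ereal" where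
  "clarke_deriv X N \<Phi> u v =
     Limsup (seminorm_nhds X N u \<times>\<^sub>F at_right 0)
       (\<lambda>(w, h). ereal ((\<Phi> (w + h *\<^sub>R v) - \<Phi> w) / h))"

definition clarke_subdiff ::
    "'x::real_vector set \<Rightarrow> ('x \<Rightarrow> real) \<Rightarrow> ('x \<Rightarrow> real) \<Rightarrow> 'x \<Rightarrow> ('x \<Rightarrow> real) set" where
  "clarke_subdiff X N \<Phi> u =
     {\<xi> \<in> dual_space X N. \<forall>v\<in>X. clarke_deriv X N \<Phi> u v \<ge> ereal (\<xi> v)}"

text \<open>On a Euclidean space functionals are identified with vectors.\<close>

definition clarke_subdiff_vec :: "('a::euclidean_space \<Rightarrow> real) \<Rightarrow> 'a \<Rightarrow> 'a set" where
  "clarke_subdiff_vec g \<xi> = {\<eta>. (\<lambda>v. \<eta> \<bullet> v) \<in> clarke_subdiff UNIV norm g \<xi>}"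

definition locally_lipschitz :: "('a::metric_space \<Rightarrow> real) \<Rightarrow> bool" where
  "locally_lipschitz g \<longleftrightarrow> (\<forall>x. \<exists>r>0. \<exists>L. L-lipschitz_on (ball x r) g)"


section \<open>Hausdorff measure\<close>

text \<open>
  The \<open>k\<close>-dimensional Hausdorff measure (\<open>k > 0\<close>), normalised to agree with \<open>k\<close>-dimensional area.
  Borel sets are measurable for the outer measure, so it restricts to a Borel measure, which is
  then completed.
\<close>

definition hausdorff_delta :: "nat \<Rightarrow> real \<Rightarrow> 'a::metric_space set \<Rightarrow> ennreal" where
  "hausdorff_delta k \<delta> A =
     (INF C \<in> {C :: nat \<Rightarrow> 'a set. A \<subseteq> (\<Union>i. C i) \<and> (\<forall>i. bounded (C i) \<and> diameter (C i) \<le> \<delta>)}.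
        (\<Sum>i. ennreal (unit_ball_vol (real k) * (diameter (C i) / 2) ^ k)))"

definition hausdorff_outer :: "nat \<Rightarrow> 'a::metric_space set \<Rightarrow> ennreal" where
  "hausdorff_outer k A = (SUP \<delta>\<in>{0<..}. hausdorff_delta k \<delta> A)"

definition hausdorff_measure :: "nat \<Rightarrow> 'a::metric_space measure" where
  "hausdorff_measure k =
     completion (measure_of UNIV (sets borel) (hausdorff_outer k))"

text \<open>Surface measure on a piece \<open>G\<close> of the boundary.\<close>

definition surface_measure :: "(real^'n) set \<Rightarrow> (real^'n) measure" where
  "surface_measure G = restrict_space (hausdorff_measure (CARD('n) - 1)) G"


section \<open>Lipschitz domains\<close>

text \<open>
  Near a boundary point the domain is the strict epigraph of a Lipschitz function over the
  hyperplane orthogonal to some unit vector \<open>e\<close>.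
\<close>

definition bounded_lipschitz_domain :: "(real^'n) set \<Rightarrow> bool" where
  "bounded_lipschitz_domain \<Omega> \<longleftrightarrow>
     \<Omega> \<noteq> {} \<and> open \<Omega> \<and> connected \<Omega> \<and> bounded \<Omega> \<and>
     (\<forall>x0\<in>frontier \<Omega>. \<exists>e r L. \<exists>g :: real^'n \<Rightarrow> real.
        norm e = 1 \<and> r > 0 \<and> L-lipschitz_on UNIV g \<and>
        (\<forall>x\<in>ball x0 r. x \<in> \<Omega> \<longleftrightarrow> g (x - (x \<bullet> e) *\<^sub>R e) < x \<bullet> e))"

text \<open>
  \<open>n\<close> is the outward normal at \<open>x\<close> if, to first order at \<open>x\<close>, the domain is the half space
  \<open>(y - x) \<bullet> n < 0\<close>. Such a vector is unique, and it exists wherever the boundary graph is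
  differentiable, hence almost everywhere on a Lipschitz boundary.
\<close>

definition is_outward_normal :: "(real^'n) set \<Rightarrow> real^'n \<Rightarrow> real^'n \<Rightarrow> bool" where
  "is_outward_normal \<Omega> x n \<longleftrightarrow> norm n = 1 \<and>
     (\<forall>\<epsilon>>0. \<exists>r>0. \<forall>y\<in>ball x r.
        ((y - x) \<bullet> n > \<epsilon> * norm (y - x) \<longrightarrow> y \<notin> \<Omega>) \<and>
        ((y - x) \<bullet> n < - (\<epsilon> * norm (y - x)) \<longrightarrow> y \<in> \<Omega>))"

definition outward_normal :: "(real^'n) set \<Rightarrow> real^'n \<Rightarrow> real^'n" where
  "outward_normal \<Omega> x = (THE n. is_outward_normal \<Omega> x n)"


section \<open>Smooth functions, weak derivatives, Sobolev space, traces\<close>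

primrec Ck :: "nat \<Rightarrow> ('a::real_normed_vector \<Rightarrow> 'b::real_normed_vector) \<Rightarrow> bool" where
  "Ck 0 f \<longleftrightarrow> continuous_on UNIV f"
| "Ck (Suc k) f \<longleftrightarrow> (\<forall>x. f differentiable (at x)) \<and>
                     (\<forall>e. Ck k (\<lambda>x. frechet_derivative f (at x) e))"

definition smooth :: "('a::real_normed_vector \<Rightarrow> 'b::real_normed_vector) \<Rightarrow> bool" where
  "smooth f \<longleftrightarrow> (\<forall>k. Ck k f)"

definition test_functions :: "'a::real_normed_vector set \<Rightarrow> ('a \<Rightarrow> real) set" where
  "test_functions U = {\<phi>. smooth \<phi> \<and> compact (closure {x. \<phi> x \<noteq> 0}) \<and> closure {x. \<phi> x \<noteq> 0} \<subseteq> U}"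

text \<open>The \<open>(i, j)\<close> entry of the weak gradient is the weak derivative of \<open>v\<^sub>i\<close> in direction \<open>j\<close>.\<close>

definition is_weak_gradient ::
    "(real^'n) set \<Rightarrow> (real^'n \<Rightarrow> real^'n) \<Rightarrow> (real^'n \<Rightarrow> real^'n^'n) \<Rightarrow> bool" where
  "is_weak_gradient \<Omega> v G \<longleftrightarrow> G \<in> L2_space (lebesgue_on \<Omega>) \<and>
     (\<forall>\<phi>\<in>test_functions \<Omega>. \<forall>i j.
        (\<integral>x. v x $ i * frechet_derivative \<phi> (at x) (axis j 1) \<partial>lebesgue_on \<Omega>) =
        - (\<integral>x. G x $ i $ j * \<phi> x \<partial>lebesgue_on \<Omega>))"

definition H1_space :: "(real^'n) set \<Rightarrow> (real^'n \<Rightarrow> real^'n) set" where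
  "H1_space \<Omega> = {v \<in> L2_space (lebesgue_on \<Omega>). \<exists>G. is_weak_gradient \<Omega> v G}"

text \<open>Determined up to null sets.\<close>

definition weak_gradient :: "(real^'n) set \<Rightarrow> (real^'n \<Rightarrow> real^'n) \<Rightarrow> real^'n \<Rightarrow> real^'n^'n" where
  "weak_gradient \<Omega> v = (SOME G. is_weak_gradient \<Omega> v G)"

definition H1_norm :: "(real^'n) set \<Rightarrow> (real^'n \<Rightarrow> real^'n) \<Rightarrow> real" where
  "H1_norm \<Omega> v = sqrt ((L2_norm (lebesgue_on \<Omega>) v)\<^sup>2 +
                       (L2_norm (lebesgue_on \<Omega>) (weak_gradient \<Omega> v))\<^sup>2)"

text \<open>
  The trace operator is the continuous extension to \<open>H\<^sup>1(\<Omega>)\<close>, with values in \<open>L\<^sup>2(\<Gamma>)\<close>, of the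
  restriction to \<open>\<Gamma>\<close> of functions smooth up to the boundary.
\<close>

definition is_trace :: "(real^'n) set \<Rightarrow> (real^'n \<Rightarrow> real^'n) \<Rightarrow> (real^'n \<Rightarrow> real^'n) \<Rightarrow> bool" where
  "is_trace \<Omega> v w \<longleftrightarrow> w \<in> L2_space (surface_measure (frontier \<Omega>)) \<and>
     (\<exists>s :: nat \<Rightarrow> real^'n \<Rightarrow> real^'n. (\<forall>k. smooth (s k)) \<and>
        (\<lambda>k. H1_norm \<Omega> (s k - v)) \<longlonglongrightarrow> 0 \<and>
        (\<lambda>k. L2_norm (surface_measure (frontier \<Omega>)) (s k - w)) \<longlonglongrightarrow> 0)"

text \<open>Determined up to null sets.\<close>

definition trace_fun :: "(real^'n) set \<Rightarrow> (real^'n \<Rightarrow> real^'n) \<Rightarrow> real^'n \<Rightarrow> real^'n" where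
  "trace_fun \<Omega> v = (SOME w. is_trace \<Omega> v w)"

definition normal_trace :: "(real^'n) set \<Rightarrow> (real^'n \<Rightarrow> real^'n) \<Rightarrow> real^'n \<Rightarrow> real" where
  "normal_trace \<Omega> v x = trace_fun \<Omega> v x \<bullet> outward_normal \<Omega> x"

definition tangential_trace :: "(real^'n) set \<Rightarrow> (real^'n \<Rightarrow> real^'n) \<Rightarrow> real^'n \<Rightarrow> real^'n" where
  "tangential_trace \<Omega> v x = trace_fun \<Omega> v x - normal_trace \<Omega> v x *\<^sub>R outward_normal \<Omega> x"

definition strain :: "(real^'n) set \<Rightarrow> (real^'n \<Rightarrow> real^'n) \<Rightarrow> real^'n \<Rightarrow> real^'n^'n" where
  "strain \<Omega> v x = (1 / 2) *\<^sub>R (weak_gradient \<Omega> v x + transpose (weak_gradient \<Omega> v x))"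

definition divergence :: "(real^'n) set \<Rightarrow> (real^'n \<Rightarrow> real^'n) \<Rightarrow> real^'n \<Rightarrow> real" where
  "divergence \<Omega> v x = (\<Sum>i\<in>UNIV. weak_gradient \<Omega> v x $ i $ i)"


section \<open>Spaces, forms and operators of the problem\<close>

type_synonym 'n vfield = "real^'n \<Rightarrow> real^'n"

text \<open>
  The boundary conditions are those of the trace. That every \<open>v\<close> in \<open>H1_space \<Omega>\<close> has one is the
  trace theorem; stating it here ensures that the choice in \<^const>\<open>trace_fun\<close> is never vacuous.
\<close>

definition V_space :: "(real^'n) set \<Rightarrow> (real^'n) set \<Rightarrow> (real^'n) set \<Rightarrow> 'n vfield set" where
  "V_space \<Omega> \<Gamma>D \<Gamma>S = {v \<in> H1_space \<Omega>. (\<exists>w. is_trace \<Omega> v w) \<and>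
     (AE x in surface_measure \<Gamma>D. trace_fun \<Omega> v x = 0) \<and>
     (AE x in surface_measure \<Gamma>S. normal_trace \<Omega> v x = 0)}"

text \<open>The inner product of \<open>real^'n^'n\<close> is the Frobenius product of matrices.\<close>

definition V_inner :: "(real^'n) set \<Rightarrow> 'n vfield \<Rightarrow> 'n vfield \<Rightarrow> real" where
  "V_inner \<Omega> u v = (\<integral>x. strain \<Omega> u x \<bullet> strain \<Omega> v x \<partial>lebesgue_on \<Omega>)"

definition V_norm :: "(real^'n) set \<Rightarrow> 'n vfield \<Rightarrow> real" where
  "V_norm \<Omega> v = sqrt (V_inner \<Omega> v v)"

definition V_dual :: "(real^'n) set \<Rightarrow> (real^'n) set \<Rightarrow> (real^'n) set \<Rightarrow> ('n vfield \<Rightarrow> real) set" where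
  "V_dual \<Omega> \<Gamma>D \<Gamma>S = dual_space (V_space \<Omega> \<Gamma>D \<Gamma>S) (V_norm \<Omega>)"

definition H_space :: "(real^'n) set \<Rightarrow> 'n vfield set" where
  "H_space \<Omega> = L2_space (lebesgue_on \<Omega>)"

definition H_norm :: "(real^'n) set \<Rightarrow> 'n vfield \<Rightarrow> real" where
  "H_norm \<Omega> = L2_norm (lebesgue_on \<Omega>)"

definition H_embed :: "(real^'n) set \<Rightarrow> 'n vfield \<Rightarrow> 'n vfield \<Rightarrow> real" where
  "H_embed \<Omega> u = (\<lambda>v. \<integral>x. u x \<bullet> v x \<partial>lebesgue_on \<Omega>)"

definition Q_space :: "(real^'n) set \<Rightarrow> (real^'n \<Rightarrow> real) set" where
  "Q_space \<Omega> = {q \<in> L2_space (lebesgue_on \<Omega>). (\<integral>x. q x \<partial>lebesgue_on \<Omega>) = 0}"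

definition S_space :: "(real^'n) set \<Rightarrow> 'n vfield set" where
  "S_space \<Gamma>S = L2_space (surface_measure \<Gamma>S)"

definition S_norm :: "(real^'n) set \<Rightarrow> 'n vfield \<Rightarrow> real" where
  "S_norm \<Gamma>S = L2_norm (surface_measure \<Gamma>S)"

definition S_dual :: "(real^'n) set \<Rightarrow> ('n vfield \<Rightarrow> real) set" where
  "S_dual \<Gamma>S = dual_space (S_space \<Gamma>S) (S_norm \<Gamma>S)"

definition VV_space ::
    "(real^'n) set \<Rightarrow> (real^'n) set \<Rightarrow> (real^'n) set \<Rightarrow> real \<Rightarrow> (real \<Rightarrow> 'n vfield) set" where
  "VV_space \<Omega> \<Gamma>D \<Gamma>S T = bochner_L2 T (V_space \<Omega> \<Gamma>D \<Gamma>S) (V_norm \<Omega>)"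

definition VV_dual ::
    "(real^'n) set \<Rightarrow> (real^'n) set \<Rightarrow> (real^'n) set \<Rightarrow> real \<Rightarrow> (real \<Rightarrow> 'n vfield \<Rightarrow> real) set" where
  "VV_dual \<Omega> \<Gamma>D \<Gamma>S T =
     bochner_L2 T (V_dual \<Omega> \<Gamma>D \<Gamma>S) (dual_norm (V_space \<Omega> \<Gamma>D \<Gamma>S) (V_norm \<Omega>))"

definition QQ_space :: "(real^'n) set \<Rightarrow> real \<Rightarrow> (real \<Rightarrow> real^'n \<Rightarrow> real) set" where
  "QQ_space \<Omega> T = bochner_L2 T (Q_space \<Omega>) (L2_norm (lebesgue_on \<Omega>))"

definition SS_dual :: "(real^'n) set \<Rightarrow> real \<Rightarrow> (real \<Rightarrow> 'n vfield \<Rightarrow> real) set" where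
  "SS_dual \<Gamma>S T = bochner_L2 T (S_dual \<Gamma>S) (dual_norm (S_space \<Gamma>S) (S_norm \<Gamma>S))"

text \<open>
  \<open>\<integral> u'(t) \<phi>(t) dt = - \<integral> u(t) \<phi>'(t) dt\<close> in \<open>V\<^sup>*\<close>, where \<open>u(t)\<close> is read as an
  element of \<open>V\<^sup>*\<close> through \<open>H\<close>; a \<open>V\<^sup>*\<close>-valued integral is evaluated at \<open>v\<close> under the integral sign.
\<close>

definition is_time_derivative ::
    "(real^'n) set \<Rightarrow> (real^'n) set \<Rightarrow> (real^'n) set \<Rightarrow> real \<Rightarrow>
     (real \<Rightarrow> 'n vfield) \<Rightarrow> (real \<Rightarrow> 'n vfield \<Rightarrow> real) \<Rightarrow> bool" where
  "is_time_derivative \<Omega> \<Gamma>D \<Gamma>S T u du \<longleftrightarrow> du \<in> VV_dual \<Omega> \<Gamma>D \<Gamma>S T \<and>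
     (\<forall>\<phi>\<in>test_functions {0<..<T}. \<forall>v\<in>V_space \<Omega> \<Gamma>D \<Gamma>S.
        (\<integral>t. \<phi> t * du t v \<partial>time_measure T) =
        - (\<integral>t. deriv \<phi> t * H_embed \<Omega> (u t) v \<partial>time_measure T))"

definition W_space ::
    "(real^'n) set \<Rightarrow> (real^'n) set \<Rightarrow> (real^'n) set \<Rightarrow> real \<Rightarrow> (real \<Rightarrow> 'n vfield) set" where
  "W_space \<Omega> \<Gamma>D \<Gamma>S T = {u \<in> VV_space \<Omega> \<Gamma>D \<Gamma>S T. \<exists>du. is_time_derivative \<Omega> \<Gamma>D \<Gamma>S T u du}"

text \<open>Determined, as a function with values in \<open>V\<^sup>*\<close>, for almost every time.\<close>

definition time_derivative ::
    "(real^'n) set \<Rightarrow> (real^'n) set \<Rightarrow> (real^'n) set \<Rightarrow> real \<Rightarrow>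
     (real \<Rightarrow> 'n vfield) \<Rightarrow> real \<Rightarrow> 'n vfield \<Rightarrow> real" where
  "time_derivative \<Omega> \<Gamma>D \<Gamma>S T u = (SOME du. is_time_derivative \<Omega> \<Gamma>D \<Gamma>S T u du)"

text \<open>
  \<open>u(0) = u\<^sub>0\<close>, read as usual for the representative of \<open>u\<close> in \<open>C([0,T];H)\<close>.
\<close>

definition has_initial_value ::
    "(real^'n) set \<Rightarrow> real \<Rightarrow> (real \<Rightarrow> 'n vfield) \<Rightarrow> 'n vfield \<Rightarrow> bool" where
  "has_initial_value \<Omega> T u u0 \<longleftrightarrow>
     (\<exists>w. (\<forall>t\<in>{0..T}. w t \<in> H_space \<Omega>) \<and>
          (\<forall>s\<in>{0..T}. ((\<lambda>t. H_norm \<Omega> (w t - w s)) \<longlongrightarrow> 0) (at s within {0..T})) \<and>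
          (AE t in time_measure T. AE x in lebesgue_on \<Omega>. u t x = w t x) \<and>
          (AE x in lebesgue_on \<Omega>. w 0 x = u0 x))"

definition a_form :: "real \<Rightarrow> (real^'n) set \<Rightarrow> 'n vfield \<Rightarrow> 'n vfield \<Rightarrow> real" where
  "a_form \<mu> \<Omega> u v = 2 * \<mu> * (\<integral>x. strain \<Omega> u x \<bullet> strain \<Omega> v x \<partial>lebesgue_on \<Omega>)"

definition b_form :: "(real^'n) set \<Rightarrow> 'n vfield \<Rightarrow> (real^'n \<Rightarrow> real) \<Rightarrow> real" where
  "b_form \<Omega> v q = (\<integral>x. q x * divergence \<Omega> v x \<partial>lebesgue_on \<Omega>)"

definition A_op :: "real \<Rightarrow> (real^'n) set \<Rightarrow> 'n vfield \<Rightarrow> ('n vfield \<Rightarrow> real)" where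
  "A_op \<mu> \<Omega> u = (\<lambda>v. a_form \<mu> \<Omega> u v)"

definition B_op :: "(real^'n) set \<Rightarrow> 'n vfield \<Rightarrow> ((real^'n \<Rightarrow> real) \<Rightarrow> real)" where
  "B_op \<Omega> v = (\<lambda>q. b_form \<Omega> v q)"

definition B_adj :: "(real^'n) set \<Rightarrow> (real^'n \<Rightarrow> real) \<Rightarrow> ('n vfield \<Rightarrow> real)" where
  "B_adj \<Omega> q = (\<lambda>v. b_form \<Omega> v q)"

abbreviation gamma_op :: "(real^'n) set \<Rightarrow> 'n vfield \<Rightarrow> 'n vfield" where
  "gamma_op \<Omega> v \<equiv> tangential_trace \<Omega> v"

definition gamma_adj :: "(real^'n) set \<Rightarrow> ('n vfield \<Rightarrow> real) \<Rightarrow> ('n vfield \<Rightarrow> real)" where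
  "gamma_adj \<Omega> \<eta> = (\<lambda>v. \<eta> (gamma_op \<Omega> v))"

definition Psi :: "(real^'n) set \<Rightarrow> (real^'n \<Rightarrow> real \<Rightarrow> real^'n \<Rightarrow> real) \<Rightarrow> real \<Rightarrow> 'n vfield \<Rightarrow> real" where
  "Psi \<Gamma>S \<psi> t z = (\<integral>x. \<psi> x t (z x) \<partial>surface_measure \<Gamma>S)"

definition Psi_clarke_deriv ::
    "(real^'n) set \<Rightarrow> (real^'n \<Rightarrow> real \<Rightarrow> real^'n \<Rightarrow> real) \<Rightarrow> real \<Rightarrow> 'n vfield \<Rightarrow> 'n vfield \<Rightarrow> ereal" where
  "Psi_clarke_deriv \<Gamma>S \<psi> t z w = clarke_deriv (S_space \<Gamma>S) (S_norm \<Gamma>S) (Psi \<Gamma>S \<psi> t) z w"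

definition Psi_subdiff ::
    "(real^'n) set \<Rightarrow> (real^'n \<Rightarrow> real \<Rightarrow> real^'n \<Rightarrow> real) \<Rightarrow> real \<Rightarrow> 'n vfield \<Rightarrow> ('n vfield \<Rightarrow> real) set" where
  "Psi_subdiff \<Gamma>S \<psi> t z = clarke_subdiff (S_space \<Gamma>S) (S_norm \<Gamma>S) (Psi \<Gamma>S \<psi> t) z"

end

theory Submission
  imports Defs
begin

text \<open>Test the equation in the dual of V with v. The friction term becomes
  \<open>\<eta> (gamma_op \<Omega> v)\<close>, the value of a Clarke subgradient of \<Psi> at the
  direction \<gamma>v, and the definition of the subdifferential bounds it above by the generalized
  directional derivative; this turns the equation into the inequality. Alternative (b) reduces to
  (a), since \<xi>(t) is itself the required subgradient. The constraint on the divergence, the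
  membership in the spaces and the initial value carry over.

  The definition of the subdifferential speaks only of directions in the carrier, so it must be
  known that \<gamma>v belongs to S (\<open>tangential_trace_in_S_space\<close>). The tangential
  trace subtracts a multiple of the pointwise normal; for v in V that multiple vanishes almost
  everywhere on \<Gamma>S, so \<gamma>v agrees almost everywhere with the full trace, which is
  square integrable. Completeness of the surface measure then transfers measurability
  (\<open>surface_measure_complete_measure\<close>, \<open>L2_space_AE_eq\<close>). The bound itself
  is \<open>clarke_subdiff_inequality\<close>.\<close>

lemma restrict_space_complete_measure:
  assumes "complete_measure M" and S: "S \<in> sets M"
  shows "complete_measure (restrict_space M S)"
proof
  interpret complete_measure M by fact
  have S': "S \<inter> space M \<in> sets M"
    using S by simp
  fix A B assume "B \<subseteq> A" and "A \<in> null_sets (restrict_space M S)"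
  then have "A \<in> null_sets M" "A \<subseteq> S"
    using null_sets_restrict_space[OF S] by auto
  with \<open>B \<subseteq> A\<close> show "B \<in> sets (restrict_space M S)"
    using complete[of B A] by (simp add: sets_restrict_space_iff[OF S'] order_trans)
qed

text \<open>Preimages of a set under \<open>f\<close> and \<open>g\<close> differ only inside a null
  set, and completeness makes every such modification of a measurable set measurable. The condition
  on the range of \<open>g\<close> is there because almost everywhere equality leaves its values on
  the exceptional set open.\<close>

lemma (in complete_measure) measurable_AE_eq:
  assumes f: "f \<in> M \<rightarrow>\<^sub>M N" and eq: "AE x in M. f x = g x" and g: "g \<in> space M \<rightarrow> space N"
  shows "g \<in> M \<rightarrow>\<^sub>M N"
proof (rule measurableI)
  show "g x \<in> space N" if "x \<in> space M" for x
    using g that by auto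
  fix A assume A: "A \<in> sets N"
  have "f -` A \<inter> space M \<in> sets M"
    using f A by (rule measurable_sets)
  moreover have "AE x in M. x \<in> f -` A \<inter> space M \<longleftrightarrow> x \<in> g -` A \<inter> space M"
    using eq by eventually_elim auto
  ultimately show "g -` A \<inter> space M \<in> sets M"
    using in_sets_AE[of "f -` A \<inter> space M" "g -` A \<inter> space M"] by auto
qed

lemma (in complete_measure) L2_space_AE_eq:
  fixes f g :: "'a \<Rightarrow> 'b::euclidean_space"
  assumes f: "f \<in> L2_space M" and eq: "AE x in M. f x = g x"
  shows "g \<in> L2_space M"
proof -
  have [measurable]: "f \<in> borel_measurable M"
    using f by (simp add: L2_space_def)
  have g [measurable]: "g \<in> borel_measurable M"
    using measurable_AE_eq[OF _ eq] by simp
  have "integrable M (\<lambda>x. (norm (f x))\<^sup>2) \<longleftrightarrow> integrable M (\<lambda>x. (norm (g x))\<^sup>2)"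
    using eq by (intro integrable_cong_AE) auto
  with f g show ?thesis
    by (simp add: L2_space_def)
qed

lemma L2_space_restrict_space:
  fixes f :: "'a \<Rightarrow> 'b::euclidean_space"
  assumes f: "f \<in> L2_space M" and S: "S \<in> sets M"
  shows "f \<in> L2_space (restrict_space M S)"
proof -
  have "integrable M (\<lambda>x. indicator S x *\<^sub>R (norm (f x))\<^sup>2)"
    using f S by (intro integrable_mult_indicator) (auto simp: L2_space_def)
  with f S show ?thesis
    by (simp add: L2_space_def measurable_restrict_space1 integrable_restrict_space)
qed

text \<open>The \<sigma>-algebra of \<open>measure_of\<close> is determined by the generating
  family, here already a \<sigma>-algebra, whatever the set function; completion only enlarges
  it.\<close>

lemma borel_sets_hausdorff_measure:
  "A \<in> sets borel \<Longrightarrow> A \<in> sets (hausdorff_measure k)"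
  unfolding hausdorff_measure_def
  by (intro sets_completionI_sets) (simp add: sigma_algebra.sets_measure_of_eq)

text \<open>Completion gives a complete measure on the whole space, and restriction to a measurable
  set preserves this.\<close>

lemma surface_measure_complete_measure:
  assumes "G \<in> sets borel"
  shows "complete_measure (surface_measure G)"
  unfolding surface_measure_def
proof (rule restrict_space_complete_measure)
  show "complete_measure (hausdorff_measure (CARD('a) - 1) :: (real^'a) measure)"
    unfolding hausdorff_measure_def by (rule completion.complete_measure_axioms)
qed (rule borel_sets_hausdorff_measure[OF assms])

text \<open>Traces are square integrable over the whole frontier, while the space S lives on
  \<Gamma>S alone; these two facts let one pass from the former to the latter.\<close>

lemma surface_measure_subset:
  assumes "G \<subseteq> F" and "G \<in> sets borel" and "F \<in> sets borel"
  shows "surface_measure G = restrict_space (surface_measure F) G"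
    and "G \<in> sets (surface_measure F)"
proof -
  show "surface_measure G = restrict_space (surface_measure F) G"
    using assms
    by (simp add: surface_measure_def restrict_restrict_space inf.absorb2 borel_sets_hausdorff_measure)
  have "G \<in> sets (hausdorff_measure (CARD('a) - 1))"
    using assms(2) by (rule borel_sets_hausdorff_measure)
  then show "G \<in> sets (surface_measure F)"
    using assms(1) by (auto simp: surface_measure_def sets_restrict_space)
qed

text \<open>
  On \<open>\<Gamma>S\<close> the normal trace vanishes almost everywhere, so the tangential trace inherits
  measurability from the full trace; the pointwise normal vector need not be shown measurable.
\<close>

lemma tangential_trace_in_S_space:
  assumes v: "v \<in> V_space \<Omega> \<Gamma>D \<Gamma>S"
    and sub: "\<Gamma>S \<subseteq> frontier \<Omega>" and borel: "\<Gamma>S \<in> sets borel"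
  shows "tangential_trace \<Omega> v \<in> S_space \<Gamma>S"
proof -
  interpret complete_measure "surface_measure \<Gamma>S"
    using borel by (rule surface_measure_complete_measure)
  obtain w where "is_trace \<Omega> v w"
    using v by (auto simp: V_space_def)
  \<comment> \<open>Some trace exists because \<open>V_space\<close> demands it, so the function
    picked by Hilbert choice is a genuine trace.\<close>
  then have "is_trace \<Omega> v (trace_fun \<Omega> v)"
    unfolding trace_fun_def by (rule someI[where P = "is_trace \<Omega> v"])
  then have "trace_fun \<Omega> v \<in> L2_space (surface_measure (frontier \<Omega>))"
    by (simp add: is_trace_def)
  then have trace: "trace_fun \<Omega> v \<in> L2_space (surface_measure \<Gamma>S)"
    using L2_space_restrict_space surface_measure_subset[OF sub borel] borel_closed[OF frontier_closed]
    by metis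
  have "AE x in surface_measure \<Gamma>S. normal_trace \<Omega> v x = 0"
    using v by (simp add: V_space_def)
  then have "AE x in surface_measure \<Gamma>S. trace_fun \<Omega> v x = tangential_trace \<Omega> v x"
    by eventually_elim (simp add: tangential_trace_def)
  with trace show ?thesis
    unfolding S_space_def by (rule L2_space_AE_eq)
qed

text \<open>Adding a real number is monotone in the extended reals, so the bound holds whether the
  limit superior is finite or not. Here \<open>r\<close> stands for the terms of the equation other
  than the subgradient, and \<open>s\<close> for the right-hand side.\<close>

lemma clarke_subdiff_inequality:
  assumes "\<eta> \<in> clarke_subdiff X N \<Phi> z" and "v \<in> X" and "r + \<eta> v = s"
  shows "ereal r + clarke_deriv X N \<Phi> z v \<ge> ereal s"
proof -
  have "ereal s = ereal r + ereal (\<eta> v)"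
    using assms(3) by simp
  also have "\<dots> \<le> ereal r + clarke_deriv X N \<Phi> z v"
    using assms(1,2) by (intro add_left_mono) (simp add: clarke_subdiff_def)
  finally show ?thesis .
qed

theorem proposition3p11:
  fixes \<Omega> \<Gamma>D \<Gamma>S :: "(real^'n) set"
    and T \<mu> :: real
    and \<psi> :: "real^'n \<Rightarrow> real \<Rightarrow> real^'n \<Rightarrow> real"
    and f :: "real \<Rightarrow> 'n vfield \<Rightarrow> real"
    and u0 :: "'n vfield"
    and u :: "real \<Rightarrow> 'n vfield"
    and p :: "real \<Rightarrow> real^'n \<Rightarrow> real"
  assumes dim: "CARD('n) \<in> {2, 3}"
    and domain: "bounded_lipschitz_domain \<Omega>"
    and boundary: "frontier \<Omega> = \<Gamma>D \<union> \<Gamma>S" "\<Gamma>D \<inter> \<Gamma>S = {}"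
      "closedin (top_of_set (frontier \<Omega>)) \<Gamma>D" "openin (top_of_set (frontier \<Omega>)) \<Gamma>S"
      "emeasure (surface_measure (frontier \<Omega>)) \<Gamma>D > 0"
      "emeasure (surface_measure (frontier \<Omega>)) \<Gamma>S > 0"
    and T: "T > 0" and mu: "\<mu> > 0"
    and f: "f \<in> VV_dual \<Omega> \<Gamma>D \<Gamma>S T"
    and u0: "u0 \<in> H_space \<Omega>"
    and psi_meas: "\<forall>\<xi>. (\<lambda>(x, t). \<psi> x t \<xi>) \<in>
        borel_measurable (completion (surface_measure \<Gamma>S \<Otimes>\<^sub>M time_measure T))"
      "\<exists>\<xi>0 \<in> L2_space (surface_measure \<Gamma>S). AE t in time_measure T.
          integrable (surface_measure \<Gamma>S) (\<lambda>x. \<psi> x t (\<xi>0 x))"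
    and psi_lipschitz: "AE (x, t) in surface_measure \<Gamma>S \<Otimes>\<^sub>M time_measure T.
        locally_lipschitz (\<psi> x t)"
    and psi_growth: "\<exists>c0>0. AE (x, t) in surface_measure \<Gamma>S \<Otimes>\<^sub>M time_measure T.
        \<forall>\<xi>. \<forall>\<eta>\<in>clarke_subdiff_vec (\<psi> x t) \<xi>. norm \<eta> \<le> c0 * (1 + norm \<xi>)"
    and psi_relaxed_monotone: "\<exists>\<alpha>>0. AE (x, t) in surface_measure \<Gamma>S \<Otimes>\<^sub>M time_measure T.
        \<forall>\<xi>1 \<xi>2. \<forall>\<eta>1\<in>clarke_subdiff_vec (\<psi> x t) \<xi>1. \<forall>\<eta>2\<in>clarke_subdiff_vec (\<psi> x t) \<xi>2.
          (\<eta>1 - \<eta>2) \<bullet> (\<xi>1 - \<xi>2) \<ge> - \<alpha> * (norm (\<xi>1 - \<xi>2))\<^sup>2"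
    and solution:
      "(u \<in> W_space \<Omega> \<Gamma>D \<Gamma>S T \<and> p \<in> QQ_space \<Omega> T \<and>
        (AE t in time_measure T.
           (\<exists>\<eta> \<in> Psi_subdiff \<Gamma>S \<psi> t (gamma_op \<Omega> (u t)).
              \<forall>v\<in>V_space \<Omega> \<Gamma>D \<Gamma>S.
                (time_derivative \<Omega> \<Gamma>D \<Gamma>S T u t + A_op \<mu> \<Omega> (u t) - B_adj \<Omega> (p t)
                   + gamma_adj \<Omega> \<eta>) v = f t v) \<and>
           (\<forall>q\<in>Q_space \<Omega>. B_op \<Omega> (u t) q = 0)) \<and>
        has_initial_value \<Omega> T u u0)
       \<or>
       (\<exists>\<xi>. u \<in> W_space \<Omega> \<Gamma>D \<Gamma>S T \<and> p \<in> QQ_space \<Omega> T \<and> \<xi> \<in> SS_dual \<Gamma>S T \<and>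
        (AE t in time_measure T.
           (\<forall>v\<in>V_space \<Omega> \<Gamma>D \<Gamma>S.
                (time_derivative \<Omega> \<Gamma>D \<Gamma>S T u t + A_op \<mu> \<Omega> (u t) - B_adj \<Omega> (p t)
                   + gamma_adj \<Omega> (\<xi> t)) v = f t v) \<and>
           \<xi> t \<in> Psi_subdiff \<Gamma>S \<psi> t (gamma_op \<Omega> (u t)) \<and>
           (\<forall>q\<in>Q_space \<Omega>. B_op \<Omega> (u t) q = 0)) \<and>
        has_initial_value \<Omega> T u u0)"
  shows "u \<in> W_space \<Omega> \<Gamma>D \<Gamma>S T \<and> p \<in> QQ_space \<Omega> T \<and>
         (AE t in time_measure T.
            (\<forall>v\<in>V_space \<Omega> \<Gamma>D \<Gamma>S.
               ereal (time_derivative \<Omega> \<Gamma>D \<Gamma>S T u t v + a_form \<mu> \<Omega> (u t) v - b_form \<Omega> v (p t))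
                 + Psi_clarke_deriv \<Gamma>S \<psi> t (gamma_op \<Omega> (u t)) (gamma_op \<Omega> v)
               \<ge> ereal (f t v)) \<and>
            (\<forall>q\<in>Q_space \<Omega>. b_form \<Omega> (u t) q = 0)) \<and>
         has_initial_value \<Omega> T u u0"
proof -
  have "\<Gamma>S \<in> sets borel"
  proof -
    \<comment> \<open>Relative openness presents \<Gamma>S as a closed set cut with an open
      one.\<close>
    obtain U where "open U" "\<Gamma>S = frontier \<Omega> \<inter> U"
      using boundary(4) by (auto simp: openin_open)
    then show ?thesis
      by (simp add: borel_closed)
  qed
  then have gamma: "gamma_op \<Omega> v \<in> S_space \<Gamma>S" if "v \<in> V_space \<Omega> \<Gamma>D \<Gamma>S" for v
    using that boundary(1) by (intro tangential_trace_in_S_space) auto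
  have incl: "AE t in time_measure T.
         (\<exists>\<eta> \<in> Psi_subdiff \<Gamma>S \<psi> t (gamma_op \<Omega> (u t)).
            \<forall>v\<in>V_space \<Omega> \<Gamma>D \<Gamma>S.
              (time_derivative \<Omega> \<Gamma>D \<Gamma>S T u t + A_op \<mu> \<Omega> (u t) - B_adj \<Omega> (p t)
                 + gamma_adj \<Omega> \<eta>) v = f t v) \<and>
         (\<forall>q\<in>Q_space \<Omega>. B_op \<Omega> (u t) q = 0)"
    using solution
  proof (elim disjE exE conjE)
    \<comment> \<open>Only (b) needs an argument, with \<open>\<xi> t\<close> as witness; under (a)
      the claim is among the assumptions and is closed by \<open>qed\<close>.\<close>
    fix \<xi>
    assume "AE t in time_measure T.
         (\<forall>v\<in>V_space \<Omega> \<Gamma>D \<Gamma>S.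
              (time_derivative \<Omega> \<Gamma>D \<Gamma>S T u t + A_op \<mu> \<Omega> (u t) - B_adj \<Omega> (p t)
                 + gamma_adj \<Omega> (\<xi> t)) v = f t v) \<and>
         \<xi> t \<in> Psi_subdiff \<Gamma>S \<psi> t (gamma_op \<Omega> (u t)) \<and>
         (\<forall>q\<in>Q_space \<Omega>. B_op \<Omega> (u t) q = 0)"
    then show ?thesis
      by eventually_elim blast
  qed
  have "AE t in time_measure T.
         (\<forall>v\<in>V_space \<Omega> \<Gamma>D \<Gamma>S.
            ereal (time_derivative \<Omega> \<Gamma>D \<Gamma>S T u t v + a_form \<mu> \<Omega> (u t) v - b_form \<Omega> v (p t))
              + Psi_clarke_deriv \<Gamma>S \<psi> t (gamma_op \<Omega> (u t)) (gamma_op \<Omega> v)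
            \<ge> ereal (f t v)) \<and>
         (\<forall>q\<in>Q_space \<Omega>. b_form \<Omega> (u t) q = 0)"
    using incl
  proof eventually_elim
    case (elim t)
    then obtain \<eta> where \<eta>: "\<eta> \<in> Psi_subdiff \<Gamma>S \<psi> t (gamma_op \<Omega> (u t))"
      and eq: "\<And>v. v \<in> V_space \<Omega> \<Gamma>D \<Gamma>S \<Longrightarrow>
        (time_derivative \<Omega> \<Gamma>D \<Gamma>S T u t + A_op \<mu> \<Omega> (u t) - B_adj \<Omega> (p t)
           + gamma_adj \<Omega> \<eta>) v = f t v"
      by blast
    have "ereal (time_derivative \<Omega> \<Gamma>D \<Gamma>S T u t v + a_form \<mu> \<Omega> (u t) v - b_form \<Omega> v (p t))
            + Psi_clarke_deriv \<Gamma>S \<psi> t (gamma_op \<Omega> (u t)) (gamma_op \<Omega> v)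
          \<ge> ereal (f t v)" if v: "v \<in> V_space \<Omega> \<Gamma>D \<Gamma>S" for v
      unfolding Psi_clarke_deriv_def
      using \<eta>[unfolded Psi_subdiff_def] gamma[OF v]
    \<comment> \<open>The subgradient property and \<gamma>v in S discharge the first two premises;
      what remains is the equation tested with \<open>v\<close>, with operators and adjoints
      unfolded into forms.\<close>
    proof (rule clarke_subdiff_inequality)
      show "time_derivative \<Omega> \<Gamma>D \<Gamma>S T u t v + a_form \<mu> \<Omega> (u t) v - b_form \<Omega> v (p t)
          + \<eta> (gamma_op \<Omega> v) = f t v"
        using eq[OF v] by (simp add: A_op_def B_adj_def gamma_adj_def)
    qed
    with elim show ?case
      by (simp add: B_op_def)
  qed
  \<comment> \<open>Both alternatives of \<open>solution\<close> contain the memberships of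
    \<open>u\<close> and \<open>p\<close> and the initial condition.\<close>
  with solution show ?thesis
    by blast
qed

end
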